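(* Let $K\in\{0,\pm1\}$, let $f:M^n\to S_K^{n+1}$ be a smooth, closed, embedded hypersurface enclosing a domain $\Omega$ with outward unit normal $\nu$, and let $u:M\to\mathbb R$ be continuous. Then for $\mathrm f(x)=\Phi(x,u(x))=\exp_{f(x)}(u(x)\nu(x))$, the oriented volume of $\mathrm f$ satisfies $$V_{n+1}^K[\mathrm f]=|\Omega|+\int_M\sum_{i=0}^nH_{n-i}(x)\,\phi_i^K(u(x))\,d\mu(x).$$ In particular, when $K=0$, $$V_{n+1}^0[\mathrm f]=|\Omega|+\int_M\sum_{k=0}^n\frac{H_k(x)}{k+1}u(x)^{k+1}\,d\mu(x).$$
   Context: $S_K^{n+1}$ is the simply connected $(n+1)$-dimensional space form of constant sectional curvature $K$ ($\mathbb S^{n+1},\mathbb R^{n+1},\mathbb H^{n+1}$ for $K=1,0,-1$). Set $s_K(t)=\sin t,\ t,\ \sinh t$ and $c_K(t)=\cos t,\ 1,\ \cosh t$ for $K=1,0,-1$ respectively. $d\mu$ is the induced measure on $M$. The second fundamental form is $A(X,Y)=\langle\overline\nabla_X\nu,Y\rangle$, with principal curvatures $\lambda_1,\dots,\lambda_n$. $H_k=\sigma_k(\lambda_1,\dots,\lambda_n)$ is the $k$-th elementary symmetric polynomial, with $H_0=1$. The normal exponential map is $\Phi:M\times\mathbb R\to S_K^{n+1}$, $\Phi(x,t)=\exp_{f(x)}(t\nu(x))$. For $i=0,\dots,n$, $\phi_i^K(s):=\int_0^s s_K(t)^{n-i}c_K(t)^i\,dt$. Definition (oriented volume of a normal graph):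 for continuous $u:M\to\mathbb R$ and $\mathrm f(x)=\Phi(x,u(x))$, $$V_{n+1}^K[\mathrm f]:=|\Omega|+\int_M\int_0^{u(x)}J(x,t)\,dt\,d\mu(x),$$ where $J(x,t)$ is the (signed) Jacobian determinant of $\Phi$ with respect to the product measure $dt\,d\mu(x)$, with sign normalised so that $J(x,0)=1$. *)

theory Defs
  imports "HOL-Analysis.Analysis"
begin

section \<open>Smooth maps and manifolds\<close>

text \<open>Only used for open \<open>S\<close>.\<close>

primrec Ck_on :: "nat \<Rightarrow> 'a::euclidean_space set \<Rightarrow> ('a \<Rightarrow> 'b::real_normed_vector) \<Rightarrow> bool" where
  "Ck_on 0 = (\<lambda>S g. continuous_on S g)"
| "Ck_on (Suc k) = (\<lambda>S g. (\<forall>z\<in>S. g differentiable (at z)) \<and>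
     (\<forall>v. Ck_on k S (\<lambda>z. frechet_derivative g (at z) v)))"

definition smooth_on :: "'a::euclidean_space set \<Rightarrow> ('a \<Rightarrow> 'b::real_normed_vector) \<Rightarrow> bool" where
  "smooth_on S g \<longleftrightarrow> (\<forall>k. Ck_on k S g)"

text \<open>An atlas is a set of pairs \<open>(U, \<psi>)\<close>, where \<open>\<psi>\<close> is the inverse of a chart: it parametrizes an
  open piece of the manifold by the open set \<open>U\<close> of the coordinate space. The dimension of the
  manifold is the cardinality of the index type \<open>'m\<close>.\<close>

type_synonym ('m, 'a) atlas = "((real^'m) set \<times> (real^'m \<Rightarrow> 'a)) set"

definition smooth_atlas :: "'a::topological_space set \<Rightarrow> ('m::finite, 'a) atlas \<Rightarrow> bool" where
  "smooth_atlas M A \<longleftrightarrow>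
     (\<forall>(U, \<psi>)\<in>A. open U \<and> openin (top_of_set M) (\<psi> ` U) \<and> homeomorphism U (\<psi> ` U) \<psi> (inv_into U \<psi>)) \<and>
     (\<Union>(U, \<psi>)\<in>A. \<psi> ` U) = M \<and>
     (\<forall>(U, \<psi>)\<in>A. \<forall>(V, \<eta>)\<in>A. smooth_on (U \<inter> \<psi> -` (\<eta> ` V)) (inv_into V \<eta> \<circ> \<psi>))"

definition smooth_map :: "('m::finite, 'a) atlas \<Rightarrow> ('a \<Rightarrow> 'b::real_normed_vector) \<Rightarrow> bool" where
  "smooth_map A g \<longleftrightarrow> (\<forall>(U, \<psi>)\<in>A. smooth_on U (g \<circ> \<psi>))"

section \<open>Space forms\<close>

definition s_fun :: "real \<Rightarrow> real \<Rightarrow> real" where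
  "s_fun K t = (if K = 1 then sin t else if K = 0 then t else sinh t)"

definition c_fun :: "real \<Rightarrow> real \<Rightarrow> real" where
  "c_fun K t = (if K = 1 then cos t else if K = 0 then 1 else cosh t)"

text \<open>For an \<open>n\<close>-element type \<open>'n\<close>, points of \<open>\<real> \<times> \<real>\<^sup>n\<^sup>+\<^sup>1\<close> are vectors \<open>p\<close> of type
  \<^typ>\<open>real ^ ('n option option)\<close>, the coordinate in \<open>\<real>\<close> being \<open>p $ None\<close>. The space form of
  curvature \<open>K\<close> is the hypersurface \<open>p\<^sub>0\<^sup>2 + K * \<bar>p'\<bar>\<^sup>2 = 1\<close>: the unit sphere for \<open>K = 1\<close>, the affine
  hyperplane \<open>p\<^sub>0 = 1\<close> for \<open>K = 0\<close>, and the upper sheet of the hyperboloid in Minkowski space for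
  \<open>K = -1\<close>. Its Riemannian metric is the restriction of \<open>K dp\<^sub>0\<^sup>2 + \<bar>dp'\<bar>\<^sup>2\<close> to tangent vectors
  (which satisfy \<open>dp\<^sub>0 = 0\<close> when \<open>K = 0\<close>).\<close>

definition space_form :: "real \<Rightarrow> (real^('n::finite option option)) set" where
  "space_form K = {p. (p $ None)\<^sup>2 + K * (\<Sum>j\<in>UNIV. (p $ Some j)\<^sup>2) = 1 \<and> (K \<le> 0 \<longrightarrow> p $ None > 0)}"

definition sf_tangent :: "real \<Rightarrow> real^('n::finite option option) \<Rightarrow> (real^('n option option)) set" where
  "sf_tangent K p = {w. p $ None * w $ None + K * (\<Sum>j\<in>UNIV. p $ Some j * w $ Some j) = 0}"

definition metric :: "real \<Rightarrow> real^('n::finite option option) \<Rightarrow> real^('n option option) \<Rightarrow> real" where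
  "metric K v w = K * v $ None * w $ None + (\<Sum>j\<in>UNIV. v $ Some j * w $ Some j)"

text \<open>Projection onto the tangent space at \<open>p\<close> along the normal \<open>p\<close>, for which
  \<open>metric K p p = K\<close>. For \<open>K = 0\<close> derivatives of curves and of tangent fields are already tangent
  and nothing is projected.\<close>

definition tangential :: "real \<Rightarrow> real^('n::finite option option) \<Rightarrow> real^('n option option) \<Rightarrow> real^('n option option)" where
  "tangential K p w = w - (K * metric K w p) *\<^sub>R p"

text \<open>The Levi-Civita connection of the space form is the tangential part of the flat one.\<close>

definition geodesic :: "real \<Rightarrow> (real \<Rightarrow> real^('n::finite option option)) \<Rightarrow> bool" where
  "geodesic K \<gamma> \<longleftrightarrow> (\<forall>t. \<gamma> t \<in> space_form K) \<and>
     (\<exists>\<gamma>' \<gamma>''. \<forall>t. (\<gamma> has_vector_derivative \<gamma>' t) (at t) \<and> (\<gamma>' has_vector_derivative \<gamma>'' t) (at t) \<and>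
        tangential K (\<gamma> t) (\<gamma>'' t) = 0)"

definition exp_map :: "real \<Rightarrow> real^('n::finite option option) \<Rightarrow> real^('n option option) \<Rightarrow> real^('n option option)" where
  "exp_map K p v = (THE q. \<exists>\<gamma>. geodesic K \<gamma> \<and> \<gamma> 0 = p \<and> (\<gamma> has_vector_derivative v) (at 0) \<and> \<gamma> 1 = q)"

text \<open>The Riemannian volume form at \<open>p\<close>: with the unit normal \<open>p\<close> in the first row, the determinant
  is \<open>\<plusminus>1\<close> on orthonormal bases of the tangent space at \<open>p\<close>, for each of the three values of \<open>K\<close>.\<close>

definition volume_form ::
  "real^('n::finite option option) \<Rightarrow> real^('n option option) \<Rightarrow> ('n \<Rightarrow> real^('n option option)) \<Rightarrow> real" where
  "volume_form p w\<^sub>0 w = det (\<chi> a. case a of None \<Rightarrow> p | Some None \<Rightarrow> w\<^sub>0 | Some (Some i) \<Rightarrow> w i)"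

section \<open>Riemannian measures\<close>

definition gram :: "real \<Rightarrow> (real^'m::finite \<Rightarrow> real^('n::finite option option)) \<Rightarrow> real^'m \<Rightarrow> real^'m^'m" where
  "gram K F z = (\<chi> i j. metric K (frechet_derivative F (at z) (axis i 1)) (frechet_derivative F (at z) (axis j 1)))"

text \<open>\<open>\<mu>\<close> is the measure on the Borel sets of \<open>M\<close> induced by the pullback metric along \<open>f\<close>; it is
  determined uniquely by its values on chart domains.\<close>

definition riemannian_measure ::
  "real \<Rightarrow> 'a::topological_space set \<Rightarrow> ('m::finite, 'a) atlas \<Rightarrow> ('a \<Rightarrow> real^('n::finite option option)) \<Rightarrow> 'a measure \<Rightarrow> bool" where
  "riemannian_measure K M A f \<mu> \<longleftrightarrow> sets \<mu> = sets (restrict_space borel M) \<and>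
     (\<forall>(U, \<psi>)\<in>A. \<forall>B\<in>sets borel. B \<subseteq> U \<longrightarrow>
        emeasure \<mu> (\<psi> ` B) = (\<integral>\<^sup>+z\<in>B. ennreal (sqrt (det (gram K (f \<circ> \<psi>) z))) \<partial>lborel))"

definition space_form_atlas :: "real \<Rightarrow> ('n::finite option, real^('n option option)) atlas" where
  "space_form_atlas K = {(U, \<psi>). open U \<and> smooth_on U \<psi> \<and> (\<forall>z\<in>U. inj (frechet_derivative \<psi> (at z))) \<and>
     openin (top_of_set (space_form K)) (\<psi> ` U) \<and> homeomorphism U (\<psi> ` U) \<psi> (inv_into U \<psi>)}"

definition space_form_volume :: "real \<Rightarrow> (real^('n::finite option option)) measure \<Rightarrow> bool" where
  "space_form_volume K vol \<longleftrightarrow> riemannian_measure K (space_form K) (space_form_atlas K) (\<lambda>p. p) vol"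

section \<open>Hypersurfaces\<close>

definition closed_embedded_hypersurface ::
  "real \<Rightarrow> 'a::topological_space set \<Rightarrow> ('n::finite, 'a) atlas \<Rightarrow> ('a \<Rightarrow> real^('n option option)) \<Rightarrow> bool" where
  "closed_embedded_hypersurface K M A f \<longleftrightarrow>
     compact M \<and> smooth_atlas M A \<and> f ` M \<subseteq> space_form K \<and> smooth_map A f \<and>
     (\<forall>(U, \<psi>)\<in>A. \<forall>z\<in>U. inj (frechet_derivative (f \<circ> \<psi>) (at z))) \<and>
     homeomorphism M (f ` M) f (inv_into M f)"

text \<open>The tangent space of \<open>M\<close> at \<open>x\<close> is identified with its image under the differential of \<open>f\<close>,
  and the differential of a map \<open>g\<close> on \<open>M\<close> at \<open>x\<close> is regarded as a map on that image.\<close>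

definition tangent_space ::
  "('n::finite, 'a) atlas \<Rightarrow> ('a \<Rightarrow> real^('n option option)) \<Rightarrow> 'a \<Rightarrow> (real^('n option option)) set" where
  "tangent_space A f x = {frechet_derivative (f \<circ> \<psi>) (at z) v | U \<psi> z v. (U, \<psi>) \<in> A \<and> z \<in> U \<and> \<psi> z = x}"

definition differential ::
  "('n::finite, 'a) atlas \<Rightarrow> ('a \<Rightarrow> real^('n option option)) \<Rightarrow> ('a \<Rightarrow> real^('n option option)) \<Rightarrow>
   'a \<Rightarrow> real^('n option option) \<Rightarrow> real^('n option option)" where
  "differential A f g x X = (THE w. \<exists>U \<psi> z v. (U, \<psi>) \<in> A \<and> z \<in> U \<and> \<psi> z = x \<and>
     frechet_derivative (f \<circ> \<psi>) (at z) v = X \<and> frechet_derivative (g \<circ> \<psi>) (at z) v = w)"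

definition orthonormal_frame ::
  "real \<Rightarrow> ('n::finite, 'a) atlas \<Rightarrow> ('a \<Rightarrow> real^('n option option)) \<Rightarrow> 'a \<Rightarrow> ('n \<Rightarrow> real^('n option option)) \<Rightarrow> bool" where
  "orthonormal_frame K A f x e \<longleftrightarrow> (\<forall>i. e i \<in> tangent_space A f x) \<and>
     (\<forall>i j. metric K (e i) (e j) = (if i = j then 1 else 0))"

definition normal_exp ::
  "real \<Rightarrow> ('a \<Rightarrow> real^('n::finite option option)) \<Rightarrow> ('a \<Rightarrow> real^('n option option)) \<Rightarrow> 'a \<Rightarrow> real \<Rightarrow> real^('n option option)" where
  "normal_exp K f \<nu> x t = exp_map K (f x) (t *\<^sub>R \<nu> x)"

definition enclosed_domain ::
  "real \<Rightarrow> 'a set \<Rightarrow> ('a \<Rightarrow> real^('n::finite option option)) \<Rightarrow> (real^('n option option)) set \<Rightarrow> bool" where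
  "enclosed_domain K M f \<Omega> \<longleftrightarrow> \<Omega> \<noteq> {} \<and> openin (top_of_set (space_form K)) \<Omega> \<and> connected \<Omega> \<and> bounded \<Omega> \<and>
     top_of_set (space_form K) frontier_of \<Omega> = f ` M"

definition outward_unit_normal ::
  "real \<Rightarrow> 'a set \<Rightarrow> ('n::finite, 'a) atlas \<Rightarrow> ('a \<Rightarrow> real^('n option option)) \<Rightarrow> (real^('n option option)) set \<Rightarrow>
   ('a \<Rightarrow> real^('n option option)) \<Rightarrow> bool" where
  "outward_unit_normal K M A f \<Omega> \<nu> \<longleftrightarrow> smooth_map A \<nu> \<and>
     (\<forall>x\<in>M. \<nu> x \<in> sf_tangent K (f x) \<and> metric K (\<nu> x) (\<nu> x) = 1 \<and>
        (\<forall>X\<in>tangent_space A f x. metric K (\<nu> x) X = 0) \<and>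
        (\<forall>\<^sub>F t in at_right 0. normal_exp K f \<nu> x (- t) \<in> \<Omega> \<and> normal_exp K f \<nu> x t \<notin> \<Omega>))"

definition second_fundamental_form ::
  "real \<Rightarrow> ('n::finite, 'a) atlas \<Rightarrow> ('a \<Rightarrow> real^('n option option)) \<Rightarrow> ('a \<Rightarrow> real^('n option option)) \<Rightarrow> 'a \<Rightarrow>
   real^('n option option) \<Rightarrow> real^('n option option) \<Rightarrow> real" where
  "second_fundamental_form K A f \<nu> x X Y = metric K (tangential K (f x) (differential A f \<nu> x X)) Y"

definition principal_curvatures ::
  "real \<Rightarrow> ('n::finite, 'a) atlas \<Rightarrow> ('a \<Rightarrow> real^('n option option)) \<Rightarrow> ('a \<Rightarrow> real^('n option option)) \<Rightarrow> 'a \<Rightarrow>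
   ('n \<Rightarrow> real) \<Rightarrow> bool" where
  "principal_curvatures K A f \<nu> x l \<longleftrightarrow> (\<exists>e. orthonormal_frame K A f x e \<and>
     (\<forall>i j. second_fundamental_form K A f \<nu> x (e i) (e j) = (if i = j then l i else 0)))"

definition elem_sym :: "nat \<Rightarrow> ('n::finite \<Rightarrow> real) \<Rightarrow> real" where
  "elem_sym k l = (\<Sum>I | card I = k. \<Prod>i\<in>I. l i)"

section \<open>Oriented volume\<close>

text \<open>The Jacobian determinant of the normal exponential map, computed in the orthonormal basis
  \<open>(\<partial>\<^sub>t, e\<^sub>1, \<dots>, e\<^sub>n)\<close> of the tangent space of \<open>M \<times> \<real>\<close>. It depends on the frame
  \<open>e\<close> only through its sign, which is then normalised to be positive at \<open>t = 0\<close>.\<close>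

definition frame_jacobian ::
  "real \<Rightarrow> ('n::finite, 'a) atlas \<Rightarrow> ('a \<Rightarrow> real^('n option option)) \<Rightarrow> ('a \<Rightarrow> real^('n option option)) \<Rightarrow>
   ('n \<Rightarrow> real^('n option option)) \<Rightarrow> 'a \<Rightarrow> real \<Rightarrow> real" where
  "frame_jacobian K A f \<nu> e x t = volume_form (normal_exp K f \<nu> x t)
     (vector_derivative (normal_exp K f \<nu> x) (at t))
     (\<lambda>i. differential A f (\<lambda>y. normal_exp K f \<nu> y t) x (e i))"

definition jacobian ::
  "real \<Rightarrow> ('n::finite, 'a) atlas \<Rightarrow> ('a \<Rightarrow> real^('n option option)) \<Rightarrow> ('a \<Rightarrow> real^('n option option)) \<Rightarrow>
   'a \<Rightarrow> real \<Rightarrow> real" where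
  "jacobian K A f \<nu> x t = (THE J. \<exists>e. orthonormal_frame K A f x e \<and>
     J = sgn (frame_jacobian K A f \<nu> e x 0) * frame_jacobian K A f \<nu> e x t)"

text \<open>The oriented volume of the normal graph \<open>x \<mapsto> normal_exp K f \<nu> x (u x)\<close>, as a function of its height
  \<open>u\<close>. The inner integral is oriented: it changes sign when its bounds are exchanged.\<close>

definition oriented_volume ::
  "real \<Rightarrow> ('n::finite, 'a) atlas \<Rightarrow> ('a \<Rightarrow> real^('n option option)) \<Rightarrow> ('a \<Rightarrow> real^('n option option)) \<Rightarrow>
   (real^('n option option)) measure \<Rightarrow> (real^('n option option)) set \<Rightarrow> 'a measure \<Rightarrow> ('a \<Rightarrow> real) \<Rightarrow> real" where
  "oriented_volume K A f \<nu> vol \<Omega> \<mu> u =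
     measure vol \<Omega> + (LINT x|\<mu>. (LBINT t=0..ereal (u x). jacobian K A f \<nu> x t))"

definition phi_fun :: "nat \<Rightarrow> real \<Rightarrow> nat \<Rightarrow> real \<Rightarrow> real" where
  "phi_fun n K i s = (LBINT t=0..ereal s. s_fun K t ^ (n - i) * c_fun K t ^ i)"

end

theory Submission
  imports Defs
begin

text \<open>The normal exponential map is \<open>\<Phi>(x, t) = c\<^sub>K(t) f(x) + s\<^sub>K(t) \<nu>(x)\<close>. At a fixed \<open>t\<close>, its differential scales
  the \<open>i\<close>-th principal direction by \<open>c\<^sub>K + \<lambda>\<^sub>i s\<^sub>K\<close>, and \<open>(\<Phi>, \<partial>\<^sub>t\<Phi>)\<close> is obtained from \<open>(f(x), \<nu>(x))\<close>
  by a matrix of determinant \<open>c\<^sub>K\<^sup>2 + K s\<^sub>K\<^sup>2 = 1\<close>, so the Jacobian is the product of the \<open>c\<^sub>K + \<lambda>\<^sub>i s\<^sub>K\<close>. Expanding the product in elementary symmetric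
  polynomials and integrating in \<open>t\<close> gives the formula pointwise on \<open>M\<close>.\<close>

section \<open>The ambient bilinear forms\<close>

text \<open>\<open>exp_map\<close>, \<open>differential\<close> and \<open>jacobian\<close> are
  definite descriptions, so each value requires uniqueness as well as a witness: uniqueness for a
  linear ODE, independence of the chart, independence of the orthonormal frame. The ODE is linear
  only once a geodesic is known to have constant speed. Frame independence holds because any
  orthonormal frame, completed by the point and the normal, has determinant \<open>1\<close> or
  \<open>-1\<close>, and the same factor occurs at time \<open>0\<close> and at time
  \<open>t\<close>. The three curvatures share one argument except where \<open>K = 0\<close>
  intervenes: there the metric is degenerate on the ambient space and the point need not be
  metrically orthogonal to its tangent vectors, so the component along the point is measured by
  \<open>pairing\<close> and removed before a metric product is taken.\<close>

lemma sum_UNIV_option: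
  fixes g :: "'a::finite option \<Rightarrow> 'b::comm_monoid_add"
  shows "(\<Sum>a\<in>UNIV. g a) = g None + (\<Sum>a\<in>UNIV. g (Some a))"
  by (simp add: UNIV_option_conv sum.reindex)

lemma prod_UNIV_option:
  fixes g :: "'a::finite option \<Rightarrow> 'b::comm_monoid_mult"
  shows "(\<Prod>a\<in>UNIV. g a) = g None * (\<Prod>a\<in>UNIV. g (Some a))"
  by (simp add: UNIV_option_conv prod.reindex)

lemma bounded_bilinear_metric:
  "bounded_bilinear (metric K :: real^('n::finite option option) \<Rightarrow> real^('n option option) \<Rightarrow> real)"
  unfolding bilinear_conv_bounded_bilinear[symmetric] bilinear_def metric_def
  by (auto intro!: linearI simp: algebra_simps sum.distrib sum_distrib_left)

text \<open>The form that defines the space form and its tangent spaces. It is \<open>K\<close> times the metric for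
  \<open>K = \<plusminus>1\<close>, but for \<open>K = 0\<close> it only sees the coordinate that the metric ignores.\<close>

definition pairing :: "real \<Rightarrow> real^('n::finite option option) \<Rightarrow> real^('n option option) \<Rightarrow> real" where
  "pairing K v w = v $ None * w $ None + K * (\<Sum>j\<in>UNIV. v $ Some j * w $ Some j)"

lemma bounded_bilinear_pairing:
  "bounded_bilinear (pairing K :: real^('n::finite option option) \<Rightarrow> real^('n option option) \<Rightarrow> real)"
  unfolding bilinear_conv_bounded_bilinear[symmetric] bilinear_def pairing_def
  by (auto intro!: linearI simp: algebra_simps sum.distrib sum_distrib_left)

lemma metric_commute: "metric K v w = metric K w v"
  by (simp add: metric_def mult_ac)

lemma pairing_commute: "pairing K v w = pairing K w v"
  by (simp add: pairing_def mult_ac)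

lemmas metric_simps =
  bounded_bilinear.add_left[OF bounded_bilinear_metric]
  bounded_bilinear.add_right[OF bounded_bilinear_metric]
  bounded_bilinear.diff_left[OF bounded_bilinear_metric]
  bounded_bilinear.diff_right[OF bounded_bilinear_metric]
  bounded_bilinear.scaleR_left[OF bounded_bilinear_metric]
  bounded_bilinear.scaleR_right[OF bounded_bilinear_metric]
  bounded_bilinear.zero_left[OF bounded_bilinear_metric]
  bounded_bilinear.zero_right[OF bounded_bilinear_metric]

lemmas pairing_simps =
  bounded_bilinear.add_left[OF bounded_bilinear_pairing]
  bounded_bilinear.add_right[OF bounded_bilinear_pairing]
  bounded_bilinear.diff_left[OF bounded_bilinear_pairing]
  bounded_bilinear.diff_right[OF bounded_bilinear_pairing]
  bounded_bilinear.scaleR_left[OF bounded_bilinear_pairing]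
  bounded_bilinear.scaleR_right[OF bounded_bilinear_pairing]
  bounded_bilinear.zero_left[OF bounded_bilinear_pairing]
  bounded_bilinear.zero_right[OF bounded_bilinear_pairing]

lemma pairing_eq_metric:
  assumes "K \<in> {0, 1, -1}" "K = 0 \<Longrightarrow> v $ None * w $ None = 0"
  shows "pairing K v w = K * metric K v w"
  using assms by (auto simp: pairing_def metric_def algebra_simps)

lemma space_form_iff: "p \<in> space_form K \<longleftrightarrow> pairing K p p = 1 \<and> (K \<le> 0 \<longrightarrow> p $ None > 0)"
  by (simp add: space_form_def pairing_def power2_eq_square)

lemma sf_tangent_iff: "w \<in> sf_tangent K p \<longleftrightarrow> pairing K p w = 0"
  by (simp add: sf_tangent_def pairing_def)

section \<open>Orthonormal frames of the tangent space\<close>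

text \<open>One family \<open>b\<close> over \<open>'n option\<close> can hold the hypersurface
  normal at \<open>None\<close> and the tangent frame at \<open>Some\<close>, so that all unit
  tangent vectors of the space form are treated alike.\<close>

definition frame_matrix :: "real^('n::finite option option) \<Rightarrow> ('n option \<Rightarrow> real^('n option option)) \<Rightarrow>
    real^('n option option)^('n option option)" where
  "frame_matrix p b = (\<chi> a. case a of None \<Rightarrow> p | Some a \<Rightarrow> b a)"

lemma volume_form_eq_det: "volume_form p w\<^sub>0 w = det (frame_matrix p (case_option w\<^sub>0 w))"
proof -
  have "(case a of None \<Rightarrow> p | Some None \<Rightarrow> w\<^sub>0 | Some (Some i) \<Rightarrow> w i) =
        (case a of None \<Rightarrow> p | Some a \<Rightarrow> case_option w\<^sub>0 w a)" for a
    by (auto split: option.split)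
  then show ?thesis
    unfolding volume_form_def frame_matrix_def by simp
qed

locale tangent_frame =
  fixes K :: real and p :: "real^('n::finite option option)" and b :: "'n option \<Rightarrow> real^('n option option)"
  assumes K: "K \<in> {0, 1, -1}"
    and point: "p \<in> space_form K"
    and tangent: "b a \<in> sf_tangent K p"
    and orthonormal: "metric K (b a) (b a') = (if a = a' then 1 else 0)"
begin

lemma pairing_point: "pairing K p p = 1"
  using point by (simp add: space_form_iff)

lemma pairing_tangent: "pairing K p (b a) = 0"
  using tangent by (simp add: sf_tangent_iff)

text \<open>Coefficients in the basis formed by \<open>p\<close> and the \<open>b a\<close>. The
  \<open>p\<close> part is subtracted because for \<open>K = 0\<close> the metric product of
  \<open>p\<close> with \<open>b a\<close> need not vanish.\<close>

definition coord :: "real^('n option option) \<Rightarrow> real^('n option option)" where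
  "coord v = (\<chi> a. case a of None \<Rightarrow> pairing K p v | Some a \<Rightarrow> metric K (b a) (v - pairing K p v *\<^sub>R p))"

lemma linear_coord: "linear coord"
  by (rule linearI) (auto simp: coord_def vec_eq_iff pairing_simps metric_simps algebra_simps
      split: option.split)

lemma matrix_coord: "matrix coord *v v = coord v"
  using fun_cong[OF matrix_vector_mul(2)[OF linear_coord]] .

lemma coord_frame: "coord (frame_matrix p b $ a) = axis a 1"
  by (auto simp: coord_def frame_matrix_def vec_eq_iff pairing_simps metric_simps axis_def
      pairing_point pairing_tangent orthonormal split: option.split)

text \<open>By \<open>coord_frame\<close> the matrix of \<open>coord\<close> is a left inverse of
  the transposed frame matrix; for square matrices it is also a right inverse. Hence the frame spans
  the ambient space.\<close>

lemma coord_inverse: "transpose (frame_matrix p b) *v coord v = v"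
proof -
  have "matrix coord ** transpose (frame_matrix p b) = mat 1"
  proof -
    have "(matrix coord ** transpose (frame_matrix p b)) $ i $ j = coord (frame_matrix p b $ j) $ i" for i j
    proof -
      have "matrix coord *v (frame_matrix p b $ j) = coord (frame_matrix p b $ j)"
        by (rule matrix_coord)
      then show ?thesis
        by (simp add: matrix_matrix_mult_def matrix_vector_mult_def transpose_def vec_eq_iff)
    qed
    then show ?thesis
      by (simp add: vec_eq_iff mat_def coord_frame axis_def)
  qed
  then have "transpose (frame_matrix p b) ** matrix coord = mat 1"
    by (simp add: matrix_left_right_inverse)
  then have "(transpose (frame_matrix p b) ** matrix coord) *v v = v"
    by (simp only: matrix_vector_mul_lid)
  then show ?thesis
    by (simp only: matrix_vector_mul_assoc[symmetric] matrix_coord matrix_vector_mul_lid)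
qed

lemma eq_zeroI:
  assumes "w \<in> sf_tangent K p" and "\<And>a. metric K (b a) w = 0"
  shows "w = 0"
proof -
  have "coord w = 0"
    using assms by (auto simp: coord_def vec_eq_iff sf_tangent_iff metric_simps split: option.split)
  then show ?thesis
    using coord_inverse[of w] by simp
qed

text \<open>Cramer's rule: the components of \<open>v\<close> along the other rows drop out, leaving
  the \<open>p\<close> coefficient.\<close>

lemma det_replace_point:
  "det (frame_matrix v b) = pairing K p v * det (frame_matrix p b)"
proof -
  have "v = (\<Sum>i\<in>UNIV. coord v $ i *s row i (frame_matrix p b))"
    using coord_inverse[of v] by (simp add: matrix_mult_sum)
  then have "frame_matrix v b =
     (\<chi> i. if i = None then \<Sum>i\<in>UNIV. coord v $ i *s row i (frame_matrix p b) else row i (frame_matrix p b))"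
    by (auto simp: frame_matrix_def vec_eq_iff row_def split: option.split)
  then have "det (frame_matrix v b) = coord v $ None * det (frame_matrix p b)"
    by (simp only: cramer_lemma_transpose)
  then show ?thesis
    by (simp add: coord_def)
qed

text \<open>For nonzero \<open>K\<close>, the frame matrix preserves the Gram matrix
  \<open>G\<close> of the ambient metric, and \<open>det G = K\<close> can be cancelled. For
  \<open>K = 0\<close> that form is degenerate, so the point is first traded for a unit vector that
  makes the matrix Euclidean orthogonal.\<close>

lemma abs_det_frame: "\<bar>det (frame_matrix p b)\<bar> = 1"
proof -
  have "det (frame_matrix p b) * det (frame_matrix p b) = 1"
  proof (cases "K = 0")
    case True
    have p0: "p $ None = 1"
      using point by (auto simp: space_form_def True power2_eq_1_iff)
    have b0: "b a $ None = 0" for a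
      using tangent[of a] by (simp add: sf_tangent_def True p0)
    \<comment> \<open>The \<open>None\<close> coordinate of \<open>p\<close> is \<open>1\<close>, so
      \<open>pairing\<close> of \<open>p\<close> with \<open>q\<close> is \<open>1\<close> and
      \<open>det_replace_point\<close> leaves the determinant unchanged.\<close>
    define q :: "real^('n option option)" where "q = axis None 1"
    have det: "det (frame_matrix q b) = det (frame_matrix p b)"
      using det_replace_point[of q] by (simp add: pairing_def q_def True p0 axis_def)
    have "frame_matrix q b ** transpose (frame_matrix q b) = mat 1"
      using orthonormal
      by (auto simp: vec_eq_iff matrix_matrix_mult_def transpose_def frame_matrix_def mat_def
          sum_UNIV_option q_def axis_def b0 metric_def True split: option.split)
    then have "det (frame_matrix q b) * det (frame_matrix q b) = 1"
      by (metis det_I det_mul det_transpose)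
    then show ?thesis
      by (simp add: det)
  next
    case False
    define G :: "real^('n option option)^('n option option)" where
      "G = (\<chi> i j. if i = j then (if i = None then K else 1) else 0)"
    have detG: "det G = K"
      by (subst det_diagonal) (simp_all add: G_def prod_UNIV_option)
    have "(B ** G) $ i $ k = B $ i $ k * (if k = None then K else 1)" for B :: "real^('n option option)^('n option option)" and i k
    proof -
      have "(B ** G) $ i $ k = (\<Sum>l\<in>UNIV. if l = k then B $ i $ l * (if k = None then K else 1) else 0)"
        unfolding matrix_matrix_mult_def G_def vec_lambda_beta by (rule sum.cong) auto
      then show ?thesis
        by simp
    qed
    then have metric_G: "(B ** G ** transpose B) $ i $ j = metric K (B $ i) (B $ j)" for B :: "real^('n option option)^('n option option)" and i j
      by (simp add: matrix_matrix_mult_def[of "B ** G"] transpose_def metric_def sum_UNIV_option mult_ac)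
    have "metric K p p = K" and "metric K p (b a) = 0" for a
      using K False pairing_point pairing_tangent pairing_eq_metric[of K p p] pairing_eq_metric[of K p "b a"]
      by auto
    then have "metric K (frame_matrix p b $ i) (frame_matrix p b $ j) = G $ i $ j" for i j
      using orthonormal
      by (auto simp: frame_matrix_def G_def metric_commute[of K "b _" p] split: option.split)
    then have "frame_matrix p b ** G ** transpose (frame_matrix p b) = G"
      by (simp only: vec_eq_iff metric_G) simp
    then have "det (frame_matrix p b) * K * det (frame_matrix p b) = K"
      by (metis det_mul det_transpose detG)
    then show ?thesis
      using False by (simp add: mult_ac)
  qed
  then show ?thesis
    by (auto simp: square_eq_1_iff)
qed

end

section \<open>The normal exponential map\<close>

lemma c_fun_has_derivative:
  assumes "K \<in> {0, 1, -1}"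
  shows "(c_fun K has_real_derivative - K * s_fun K t) (at t)"
  using assms unfolding c_fun_def s_fun_def
  by (auto intro!: derivative_eq_intros)

lemma s_fun_has_derivative:
  assumes "K \<in> {0, 1, -1}"
  shows "(s_fun K has_real_derivative c_fun K t) (at t)"
  using assms unfolding c_fun_def s_fun_def
  by (auto intro!: derivative_eq_intros)

lemma c_fun_s_fun_identity:
  assumes "K \<in> {0, 1, -1}"
  shows "c_fun K t * c_fun K t + K * (s_fun K t * s_fun K t) = 1"
  using assms sin_cos_squared_add[of t] cosh_square_eq[of t]
  by (auto simp: c_fun_def s_fun_def power2_eq_square)

lemma c_fun_0 [simp]: "c_fun K 0 = 1" and s_fun_0 [simp]: "s_fun K 0 = 0"
  by (simp_all add: c_fun_def s_fun_def)

text \<open>The Wronskians of the solution with \<open>C\<close> and with \<open>S\<close> are constant, and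
  \<open>C S' - C' S = 1\<close>.\<close>

lemma linear_ode_solution:
  fixes \<gamma> :: "real \<Rightarrow> 'v::euclidean_space"
  assumes \<gamma>: "\<And>r. (\<gamma> has_vector_derivative \<gamma>' r) (at r)"
    and \<gamma>': "\<And>r. (\<gamma>' has_vector_derivative (- k) *\<^sub>R \<gamma> r) (at r)"
    and C: "\<And>r. (C has_real_derivative - k * S r) (at r)"
    and S: "\<And>r. (S has_real_derivative C r) (at r)"
    and init: "C 0 = 1" "S 0 = 0"
  shows "\<gamma> r = C r *\<^sub>R \<gamma> 0 + S r *\<^sub>R \<gamma>' 0"
proof -
  have const: "g r = g 0" if "\<And>r. (g has_vector_derivative 0) (at r)" for g :: "real \<Rightarrow> 'w::euclidean_space" and r
    using has_vector_derivative_zero_constant[of UNIV g] that by (metis UNIV_I convex_UNIV)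
  have "((\<lambda>r. C r * C r + k * (S r * S r)) has_vector_derivative 0) (at r)" for r
    using C S by (auto simp flip: has_real_derivative_iff_has_vector_derivative intro!: derivative_eq_intros)
  from const[OF this] have CS: "C r * C r + k * (S r * S r) = 1"
    by (simp add: init)
  have "((\<lambda>r. C r *\<^sub>R \<gamma> r - S r *\<^sub>R \<gamma>' r) has_vector_derivative 
      (C r *\<^sub>R \<gamma>' r + (- k * S r) *\<^sub>R \<gamma> r) - (S r *\<^sub>R ((- k) *\<^sub>R \<gamma> r) + C r *\<^sub>R \<gamma>' r)) (at r)" for r
    by (intro has_vector_derivative_diff has_vector_derivative_scaleR C S \<gamma> \<gamma>')
  then have "((\<lambda>r. C r *\<^sub>R \<gamma> r - S r *\<^sub>R \<gamma>' r) has_vector_derivative 0) (at r)" for r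
    by (simp add: algebra_simps)
  from const[OF this] have W1: "C r *\<^sub>R \<gamma> r - S r *\<^sub>R \<gamma>' r = \<gamma> 0"
    by (simp add: init)
  have "((\<lambda>r. (k * S r) *\<^sub>R \<gamma> r + C r *\<^sub>R \<gamma>' r) has_vector_derivative 
      ((k * S r) *\<^sub>R \<gamma>' r + (k * C r) *\<^sub>R \<gamma> r) + (C r *\<^sub>R ((- k) *\<^sub>R \<gamma> r) + (- k * S r) *\<^sub>R \<gamma>' r)) (at r)" for r
    by (intro has_vector_derivative_add has_vector_derivative_scaleR C S \<gamma> \<gamma>' DERIV_cmult)
  then have "((\<lambda>r. (k * S r) *\<^sub>R \<gamma> r + C r *\<^sub>R \<gamma>' r) has_vector_derivative 0) (at r)" for r
    by (simp add: algebra_simps)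
  from const[OF this] have W2: "(k * S r) *\<^sub>R \<gamma> r + C r *\<^sub>R \<gamma>' r = \<gamma>' 0"
    by (simp add: init)
  \<comment> \<open>\<open>W1\<close> and \<open>W2\<close> are linear in the solution and its
    velocity; this combination eliminates the velocity.\<close>
  have "C r *\<^sub>R \<gamma> 0 + S r *\<^sub>R \<gamma>' 0 = (C r * C r + k * (S r * S r)) *\<^sub>R \<gamma> r"
    unfolding W1[symmetric] W2[symmetric] by (simp add: algebra_simps)
  then show ?thesis
    by (simp add: CS)
qed

lemma bilinear_self_derivative_constant:
  fixes \<gamma> :: "real \<Rightarrow> 'v::euclidean_space" and h :: "'v \<Rightarrow> 'v \<Rightarrow> real"
  assumes h: "bounded_bilinear h" "\<And>v w. h v w = h w v"
    and \<gamma>: "(\<gamma> has_vector_derivative \<gamma>') (at r)" and "\<And>r. h (\<gamma> r) (\<gamma> r) = c"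
  shows "h (\<gamma> r) \<gamma>' = 0"
proof -
  have "((\<lambda>r. h (\<gamma> r) (\<gamma> r)) has_vector_derivative h (\<gamma> r) \<gamma>' + h \<gamma>' (\<gamma> r)) (at r)"
    by (rule bounded_bilinear.has_vector_derivative[OF h(1) \<gamma> \<gamma>])
  moreover have "((\<lambda>r. h (\<gamma> r) (\<gamma> r)) has_vector_derivative 0) (at r)"
    by (simp add: assms(4))
  ultimately have "h (\<gamma> r) \<gamma>' + h \<gamma>' (\<gamma> r) = 0"
    by (rule vector_derivative_unique_at)
  then show ?thesis
    using h(2)[of \<gamma>'] by simp
qed

text \<open>For nonzero \<open>K\<close>, the tangential condition makes the acceleration a multiple
  of the position. Differentiating the orthogonality of position and velocity gives the coefficient,
  minus the \<open>pairing\<close> square of the velocity, which is constant because acceleration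
  and velocity are orthogonal. The geodesic equation thus becomes linear with a constant
  coefficient.\<close>

lemma geodesic_acceleration:
  fixes \<gamma> :: "real \<Rightarrow> real^('n::finite option option)"
  assumes K: "K \<in> {0, 1, -1}" and \<gamma>: "\<And>r. \<gamma> r \<in> space_form K"
    and d1: "\<And>r. (\<gamma> has_vector_derivative \<gamma>' r) (at r)"
    and d2: "\<And>r. (\<gamma>' has_vector_derivative \<gamma>'' r) (at r)"
    and geo: "\<And>r. tangential K (\<gamma> r) (\<gamma>'' r) = 0"
  shows "\<gamma>'' r = (- (K * metric K (\<gamma>' 0) (\<gamma>' 0))) *\<^sub>R \<gamma> r"
proof (cases "K = 0")
  case True
  then show ?thesis
    using geo[of r] by (simp add: tangential_def)
next
  case False
  have eq: "K * metric K v w = pairing K v w" for v w :: "real^('n option option)"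
    using pairing_eq_metric[OF K, of v w] False by simp
  have acc: "\<gamma>'' r = pairing K (\<gamma>'' r) (\<gamma> r) *\<^sub>R \<gamma> r" for r
    using geo[of r] by (simp add: tangential_def eq)
  have orth: "pairing K (\<gamma> r) (\<gamma>' r) = 0" for r
    using \<gamma> by (intro bilinear_self_derivative_constant[OF bounded_bilinear_pairing pairing_commute d1])
      (auto simp: space_form_iff)
  have "((\<lambda>r. pairing K (\<gamma> r) (\<gamma>' r)) has_vector_derivative
      pairing K (\<gamma> r) (\<gamma>'' r) + pairing K (\<gamma>' r) (\<gamma>' r)) (at r)" for r
    by (rule bounded_bilinear.has_vector_derivative[OF bounded_bilinear_pairing d1 d2])
  moreover have "((\<lambda>r. pairing K (\<gamma> r) (\<gamma>' r)) has_vector_derivative 0) (at r)" for r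
    by (simp add: orth)
  ultimately have "pairing K (\<gamma> r) (\<gamma>'' r) + pairing K (\<gamma>' r) (\<gamma>' r) = 0" for r
    by (rule vector_derivative_unique_at)
  then have coeff: "pairing K (\<gamma>'' r) (\<gamma> r) = - pairing K (\<gamma>' r) (\<gamma>' r)" for r
    by (simp add: pairing_commute[of K "\<gamma>'' r"] eq_neg_iff_add_eq_0)
  have "pairing K (\<gamma>' r) (\<gamma>'' r) = 0" for r
    by (subst acc) (simp add: pairing_simps pairing_commute[of K "\<gamma>' r" "\<gamma> r"] orth)
  then have "((\<lambda>r. pairing K (\<gamma>' r) (\<gamma>' r)) has_vector_derivative 0) (at r)" for r
    using bounded_bilinear.has_vector_derivative[OF bounded_bilinear_pairing d2 d2, of K r]
    by (simp add: pairing_commute[of K "\<gamma>'' r" "\<gamma>' r"])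
  then have "pairing K (\<gamma>' r) (\<gamma>' r) = pairing K (\<gamma>' 0) (\<gamma>' 0)"
    using has_vector_derivative_zero_constant[of UNIV "\<lambda>r. pairing K (\<gamma>' r) (\<gamma>' r)"] by (metis UNIV_I convex_UNIV)
  then show ?thesis
    using acc[of r] coeff[of r] by (simp add: eq)
qed

text \<open>For \<open>K = -1\<close> the normal vector is spacelike, so a point on the lower sheet would give
  \<open>p\<^sub>0 cosh t + N\<^sub>0 sinh t < 0\<close>, contradicting \<open>\<bar>N\<^sub>0\<bar> < p\<^sub>0\<close>.\<close>

lemma normal_curve_in_space_form:
  fixes p :: "real^('n::finite option option)"
  assumes K: "K \<in> {0, 1, -1}" and p: "p \<in> space_form K" and N: "N \<in> sf_tangent K p" "metric K N N = 1"
  shows "c_fun K t *\<^sub>R p + s_fun K t *\<^sub>R N \<in> space_form K"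
proof -
  have pp: "pairing K p p = 1" and pN: "pairing K p N = 0" "pairing K N p = 0"
    using p N by (auto simp: space_form_iff sf_tangent_iff pairing_commute)
  have N0: "K = 0 \<Longrightarrow> N $ None = 0"
    using p N by (auto simp: space_form_iff sf_tangent_def)
  then have NN: "pairing K N N = K"
    using pairing_eq_metric[OF K, of N N] N by simp
  have "pairing K (c_fun K t *\<^sub>R p + s_fun K t *\<^sub>R N) (c_fun K t *\<^sub>R p + s_fun K t *\<^sub>R N) = 1"
    using c_fun_s_fun_identity[OF K, of t] by (simp add: pairing_simps pp pN NN mult_ac)
  moreover have "c_fun K t * p $ None + s_fun K t * N $ None > 0" if "K \<le> 0"
  proof (cases "K = 0")
    case True
    then show ?thesis
      using p N0 by (simp add: space_form_iff c_fun_def)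
  next
    case False
    with K that have K: "K = -1" by auto
    have p0: "p $ None > 0"
      using p K by (simp add: space_form_iff)
    let ?p = "\<Sum>j\<in>UNIV. (p $ Some j)\<^sup>2" and ?N = "\<Sum>j\<in>UNIV. (N $ Some j)\<^sup>2"
    have "(p $ None * N $ None)\<^sup>2 = (\<Sum>j\<in>UNIV. p $ Some j * N $ Some j)\<^sup>2"
      using pN by (simp add: pairing_def K)
    also have "\<dots> \<le> ?p * ?N"
      by (rule Cauchy_Schwarz_ineq_sum)
    \<comment> \<open>The values \<open>1\<close> and \<open>-1\<close> of \<open>pairing\<close> on
      \<open>p\<close> and on \<open>N\<close> give both sums. After cancelling the common product,
      the inequality says that \<open>(N $ None)\<^sup>2 + 1\<close> is at most
      \<open>(p $ None)\<^sup>2\<close>.\<close>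
    also have "\<dots> = ((p $ None)\<^sup>2 - 1) * ((N $ None)\<^sup>2 + 1)"
      using pp NN by (simp add: pairing_def K power2_eq_square algebra_simps)
    finally have "(N $ None)\<^sup>2 < (p $ None)\<^sup>2"
      by (simp add: power_mult_distrib algebra_simps)
    then have N_less: "\<bar>N $ None\<bar> < p $ None"
      using p0 power2_less_imp_less[of "\<bar>N $ None\<bar>" "p $ None"] by simp
    have "\<bar>sinh t\<bar> < cosh t"
      using cosh_square_eq[of t] power2_less_imp_less[of "\<bar>sinh t\<bar>" "cosh t"] by simp
    then have "\<bar>sinh t\<bar> * \<bar>N $ None\<bar> < cosh t * p $ None"
      using N_less p0 by (intro mult_strict_mono') auto
    then have "- (sinh t * N $ None) < cosh t * p $ None"
      by (simp add: abs_mult[symmetric])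
    then show ?thesis
      using K by (simp add: c_fun_def s_fun_def)
  qed
  ultimately show ?thesis
    by (simp add: space_form_iff)
qed

text \<open>The explicit curve is the witness. Any rival geodesic has the same initial data and
  obeys a linear ODE with constant \<open>K * t\<^sup>2\<close>, hence agrees with it.\<close>

lemma exp_map_normal:
  fixes p :: "real^('n::finite option option)"
  assumes K: "K \<in> {0, 1, -1}" and p: "p \<in> space_form K" and N: "N \<in> sf_tangent K p" "metric K N N = 1"
  shows "exp_map K p (t *\<^sub>R N) = c_fun K t *\<^sub>R p + s_fun K t *\<^sub>R N"
  unfolding exp_map_def
proof (rule the_equality)
  let ?\<gamma> = "\<lambda>r. c_fun K (t * r) *\<^sub>R p + s_fun K (t * r) *\<^sub>R N"
  have dc: "((\<lambda>r. c_fun K (t * r)) has_real_derivative - K * s_fun K (t * r) * t) (at r)"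
    and ds: "((\<lambda>r. s_fun K (t * r)) has_real_derivative c_fun K (t * r) * t) (at r)" for r
    using DERIV_chain2[OF c_fun_has_derivative[OF K] DERIV_cmult[OF DERIV_ident, of t]]
      DERIV_chain2[OF s_fun_has_derivative[OF K] DERIV_cmult[OF DERIV_ident, of t]] by simp_all
  let ?\<gamma>' = "\<lambda>r. (- K * s_fun K (t * r) * t) *\<^sub>R p + (c_fun K (t * r) * t) *\<^sub>R N"
  let ?\<gamma>'' = "\<lambda>r. (- K * (c_fun K (t * r) * t) * t) *\<^sub>R p + (- K * s_fun K (t * r) * t * t) *\<^sub>R N"
  have d1: "(?\<gamma> has_vector_derivative ?\<gamma>' r) (at r)" for r
    using dc[of r] ds[of r] by (auto intro!: derivative_eq_intros)
  have d2: "(?\<gamma>' has_vector_derivative ?\<gamma>'' r) (at r)" for r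
    using dc[of r] ds[of r] by (auto intro!: derivative_eq_intros)
  have \<gamma>: "?\<gamma> r \<in> space_form K" for r
    by (rule normal_curve_in_space_form[OF assms])
  have acc: "?\<gamma>'' r = (- K * t\<^sup>2) *\<^sub>R ?\<gamma> r" for r
    by (simp add: algebra_simps power2_eq_square)
  have geo: "tangential K (?\<gamma> r) (?\<gamma>'' r) = 0" for r
  proof (cases "K = 0")
    case False
    then have "K * metric K (?\<gamma> r) (?\<gamma> r) = 1"
      using pairing_eq_metric[OF K, of "?\<gamma> r" "?\<gamma> r"] \<gamma>[of r] by (simp add: space_form_iff)
    moreover have "tangential K v (a *\<^sub>R v) = 0" if "K * metric K v v = 1" for v :: "real^('n option option)" and a
      using that by (simp add: tangential_def metric_simps mult.left_commute)
    ultimately show ?thesis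
      by (simp only: acc)
  qed (simp add: acc tangential_def)
  have "geodesic K ?\<gamma>"
    unfolding geodesic_def
    by (intro conjI allI exI[of _ ?\<gamma>'] exI[of _ ?\<gamma>'']) (rule \<gamma> d1 d2 geo)+
  then show "\<exists>\<gamma>. geodesic K \<gamma> \<and> \<gamma> 0 = p \<and> (\<gamma> has_vector_derivative t *\<^sub>R N) (at 0) \<and>
      \<gamma> 1 = c_fun K t *\<^sub>R p + s_fun K t *\<^sub>R N"
    using d1[of 0] by (intro exI[of _ ?\<gamma>]) simp
  fix q
  assume "\<exists>\<gamma>. geodesic K \<gamma> \<and> \<gamma> 0 = p \<and> (\<gamma> has_vector_derivative t *\<^sub>R N) (at 0) \<and> \<gamma> 1 = q"
  then obtain \<eta> \<eta>' \<eta>'' where \<eta>: "\<And>r. \<eta> r \<in> space_form K" "\<And>r. (\<eta> has_vector_derivative \<eta>' r) (at r)"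
      "\<And>r. (\<eta>' has_vector_derivative \<eta>'' r) (at r)" "\<And>r. tangential K (\<eta> r) (\<eta>'' r) = 0"
    and init: "\<eta> 0 = p" "(\<eta> has_vector_derivative t *\<^sub>R N) (at 0)" "\<eta> 1 = q"
    unfolding geodesic_def by blast
  have \<eta>'0: "\<eta>' 0 = t *\<^sub>R N"
    using \<eta>(2)[of 0] init(2) by (rule vector_derivative_unique_at)
  define k where "k = K * t\<^sup>2"
  have acc: "\<eta>'' r = (- k) *\<^sub>R \<eta> r" for r
    using geodesic_acceleration[OF K \<eta>, of r] by (simp add: \<eta>'0 metric_simps N k_def power2_eq_square)
  \<comment> \<open>Dividing by \<open>t\<close> makes the derivative of \<open>S\<close> equal to
    \<open>c_fun K (t * r)\<close>; at \<open>t = 0\<close> the limit \<open>r\<close> of the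
    quotient takes over.\<close>
  define S where "S r = (if t = 0 then r else s_fun K (t * r) / t)" for r
  have dS: "(S has_real_derivative c_fun K (t * r)) (at r)" for r
    unfolding S_def using ds[of r] by (cases "t = 0") (auto intro!: derivative_eq_intros)
  have dC: "((\<lambda>r. c_fun K (t * r)) has_real_derivative - k * S r) (at r)" for r
    using dc[of r] by (cases "t = 0") (simp_all add: S_def k_def power2_eq_square mult_ac)
  have d\<eta>': "(\<eta>' has_vector_derivative (- k) *\<^sub>R \<eta> r) (at r)" for r
    using \<eta>(3)[of r] by (simp add: acc)
  have "\<eta> 1 = c_fun K (t * 1) *\<^sub>R \<eta> 0 + S 1 *\<^sub>R \<eta>' 0"
    by (rule linear_ode_solution[where k = k and C = "\<lambda>r. c_fun K (t * r)" and S = S, OF \<eta>(2) d\<eta>' dC dS]) (simp_all add: S_def)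
  then show "q = c_fun K t *\<^sub>R p + s_fun K t *\<^sub>R N"
    using init by (simp add: \<eta>'0 S_def)
qed

section \<open>Differentials on the hypersurface\<close>

lemma smooth_on_differentiable: "smooth_on S g \<Longrightarrow> z \<in> S \<Longrightarrow> g differentiable (at z)"
  unfolding smooth_on_def by (metis Ck_on.simps(2))

lemma smooth_atlasD:
  assumes "smooth_atlas M A" "(U, \<psi>) \<in> A"
  shows "open U" "openin (top_of_set M) (\<psi> ` U)" "homeomorphism U (\<psi> ` U) \<psi> (inv_into U \<psi>)" "\<psi> ` U \<subseteq> M"
proof -
  have *: "\<forall>(U, \<psi>)\<in>A. open U \<and> openin (top_of_set M) (\<psi> ` U) \<and> homeomorphism U (\<psi> ` U) \<psi> (inv_into U \<psi>)"
    using assms(1) by (simp add: smooth_atlas_def)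
  show "open U" "openin (top_of_set M) (\<psi> ` U)" "homeomorphism U (\<psi> ` U) \<psi> (inv_into U \<psi>)"
    using bspec[OF * assms(2)] by simp_all
  then show "\<psi> ` U \<subseteq> M"
    by (simp add: openin_imp_subset)
qed

lemma smooth_atlas_transition_smooth:
  assumes "smooth_atlas M A" "(U, \<psi>) \<in> A" "(V, \<eta>) \<in> A"
  shows "smooth_on (U \<inter> \<psi> -` (\<eta> ` V)) (inv_into V \<eta> \<circ> \<psi>)"
proof -
  have *: "\<forall>(U, \<psi>)\<in>A. \<forall>(V, \<eta>)\<in>A. smooth_on (U \<inter> \<psi> -` (\<eta> ` V)) (inv_into V \<eta> \<circ> \<psi>)"
    using assms(1) by (simp add: smooth_atlas_def)
  show ?thesis
    using bspec[OF bspec[OF * assms(2), simplified] assms(3)] by simp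
qed

lemma smooth_atlas_transition:
  assumes A: "smooth_atlas M A" and U: "(U, \<psi>) \<in> A" "z \<in> U" and V: "(V, \<eta>) \<in> A" "z' \<in> V" "\<eta> z' = \<psi> z"
  obtains \<tau> W where "open W" "z \<in> W" "\<tau> differentiable (at z)" "\<tau> z = z'" "\<And>y. y \<in> W \<Longrightarrow> \<eta> (\<tau> y) = \<psi> y"
proof
  let ?\<tau> = "inv_into V \<eta> \<circ> \<psi>" and ?W = "U \<inter> \<psi> -` (\<eta> ` V)"
  note U' = smooth_atlasD[OF A U(1)] and V' = smooth_atlasD[OF A V(1)]
  have "smooth_on ?W ?\<tau>"
    by (rule smooth_atlas_transition_smooth[OF A U(1) V(1)])
  moreover show z: "z \<in> ?W"
    using U V by (auto simp flip: V(3))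
  ultimately show "?\<tau> differentiable (at z)"
    by (rule smooth_on_differentiable)
  have "\<psi> \<in> U \<rightarrow> M" "continuous_on U \<psi>"
    using U' by (auto simp: homeomorphism_def)
  then have "openin (top_of_set U) ?W"
    using V' by (intro continuous_openin_preimage)
  then show "open ?W"
    using U' by (simp add: openin_open_eq)
  show "?\<tau> z = z'"
    using V' V by (simp add: homeomorphism_def flip: V(3))
  show "\<eta> (?\<tau> y) = \<psi> y" if "y \<in> ?W" for y
    using that by (simp add: f_inv_into_f)
qed

text \<open>The same linear map, the derivative of \<open>\<tau>\<close>, serves every
  \<open>g\<close>; this is what makes \<open>differential\<close> independent of the chart.\<close>

lemma frechet_derivative_transition:
  assumes "open W" "z \<in> W" "\<tau> differentiable (at z)" "\<tau> z = z'" "\<And>y. y \<in> W \<Longrightarrow> \<eta> (\<tau> y) = \<psi> y"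
    and g: "(g \<circ> \<eta>) differentiable (at z')"
  shows "frechet_derivative (g \<circ> \<psi>) (at z) v
    = frechet_derivative (g \<circ> \<eta>) (at z') (frechet_derivative \<tau> (at z) v)"
proof -
  have "frechet_derivative ((g \<circ> \<eta>) \<circ> \<tau>) (at z) = frechet_derivative (g \<circ> \<eta>) (at z') \<circ> frechet_derivative \<tau> (at z)"
    using frechet_derivative_compose[of \<tau> z "g \<circ> \<eta>"] assms by simp
  moreover have "(g \<circ> \<eta> \<circ> \<tau>) differentiable (at z)"
    using assms by (intro differentiable_chain_at) simp_all
  then have "frechet_derivative (g \<circ> \<eta> \<circ> \<tau>) (at z) = frechet_derivative (g \<circ> \<psi>) (at z)"
    using assms by (intro frechet_derivative_transform_within_open[of _ _ W]) auto
  ultimately show ?thesis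
    by simp
qed

context
  fixes K :: real and M :: "'a::topological_space set" and A :: "('n::finite, 'a) atlas"
    and f :: "'a \<Rightarrow> real^('n option option)"
  assumes hyp: "closed_embedded_hypersurface K M A f"
begin

lemma atlas: "smooth_atlas M A"
  using hyp by (simp add: closed_embedded_hypersurface_def)

lemma chart_at:
  assumes "x \<in> M"
  obtains U \<psi> z where "(U, \<psi>) \<in> A" "z \<in> U" "\<psi> z = x"
proof -
  have "x \<in> (\<Union>(U, \<psi>)\<in>A. \<psi> ` U)"
    using assms atlas by (simp add: smooth_atlas_def)
  then show thesis
    by (auto intro: that)
qed

lemma differentiable_chart:
  assumes "smooth_map A g" "(U, \<psi>) \<in> A" "z \<in> U"
  shows "(g \<circ> \<psi>) differentiable (at z)"
  using bspec[OF assms(1)[unfolded smooth_map_def] assms(2)] assms(3) by (simp add: smooth_on_differentiable)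

lemma immersion_differentiable: "(U, \<psi>) \<in> A \<Longrightarrow> z \<in> U \<Longrightarrow> (f \<circ> \<psi>) differentiable (at z)"
  using hyp by (intro differentiable_chart) (simp_all add: closed_embedded_hypersurface_def)

lemma immersion_inj: "(U, \<psi>) \<in> A \<Longrightarrow> z \<in> U \<Longrightarrow> inj (frechet_derivative (f \<circ> \<psi>) (at z))"
proof -
  assume "(U, \<psi>) \<in> A" "z \<in> U"
  moreover have "\<forall>(U, \<psi>)\<in>A. \<forall>z\<in>U. inj (frechet_derivative (f \<circ> \<psi>) (at z))"
    using hyp by (simp add: closed_embedded_hypersurface_def)
  ultimately show ?thesis
    by auto
qed

text \<open>Vectors coming from another chart are carried by the derivative of the transition map
  into the range for \<open>\<psi>\<close>, so the union over all charts collapses.\<close>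

lemma tangent_space_chart:
  assumes U: "(U, \<psi>) \<in> A" "z \<in> U"
  shows "tangent_space A f (\<psi> z) = range (frechet_derivative (f \<circ> \<psi>) (at z))"
proof -
  have "frechet_derivative (f \<circ> \<eta>) (at z') v \<in> range (frechet_derivative (f \<circ> \<psi>) (at z))"
    if V: "(V, \<eta>) \<in> A" "z' \<in> V" "\<eta> z' = \<psi> z" for V \<eta> z' v
  proof -
    obtain \<tau> W where *: "open W" "z' \<in> W" "\<tau> differentiable (at z')" "\<tau> z' = z" "\<And>y. y \<in> W \<Longrightarrow> \<psi> (\<tau> y) = \<eta> y"
      by (rule smooth_atlas_transition[OF atlas V(1,2) U V(3)[symmetric]]) (rule that)
    show ?thesis
      by (simp add: frechet_derivative_transition[OF * immersion_differentiable[OF U]])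
  qed
  moreover have "frechet_derivative (f \<circ> \<psi>) (at z) v \<in> tangent_space A f (\<psi> z)" for v
    unfolding tangent_space_def using U by (intro CollectI exI conjI) simp_all
  ultimately show ?thesis
    by (auto simp: tangent_space_def)
qed

text \<open>Injectivity of the derivative of \<open>f \<circ> \<psi>\<close> forces coordinate
  vectors of the same tangent vector to correspond under the transition map; the derivatives of
  \<open>g\<close> then agree by the chain rule.\<close>

lemma differential_chart:
  fixes g :: "'a \<Rightarrow> real^('n option option)"
  assumes g: "\<And>V \<eta> y. (V, \<eta>) \<in> A \<Longrightarrow> y \<in> V \<Longrightarrow> (g \<circ> \<eta>) differentiable (at y)"
    and U: "(U, \<psi>) \<in> A" "z \<in> U"
  shows "differential A f g (\<psi> z) (frechet_derivative (f \<circ> \<psi>) (at z) v) = frechet_derivative (g \<circ> \<psi>) (at z) v"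
  unfolding differential_def
proof (rule the_equality)
  fix w
  assume "\<exists>V \<eta> y v'. (V, \<eta>) \<in> A \<and> y \<in> V \<and> \<eta> y = \<psi> z \<and>
     frechet_derivative (f \<circ> \<eta>) (at y) v' = frechet_derivative (f \<circ> \<psi>) (at z) v \<and>
     frechet_derivative (g \<circ> \<eta>) (at y) v' = w"
  then obtain V \<eta> y v' where V: "(V, \<eta>) \<in> A" "y \<in> V" "\<eta> y = \<psi> z"
    and v': "frechet_derivative (f \<circ> \<eta>) (at y) v' = frechet_derivative (f \<circ> \<psi>) (at z) v"
      "frechet_derivative (g \<circ> \<eta>) (at y) v' = w"
    by (elim exE conjE)
  obtain \<tau> W where *: "open W" "y \<in> W" "\<tau> differentiable (at y)" "\<tau> y = z" "\<And>y. y \<in> W \<Longrightarrow> \<psi> (\<tau> y) = \<eta> y"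
    by (rule smooth_atlas_transition[OF atlas V(1,2) U V(3)[symmetric]]) (rule that)
  have "frechet_derivative \<tau> (at y) v' = v"
    using v'(1) injD[OF immersion_inj[OF U]]
    by (simp add: frechet_derivative_transition[OF * immersion_differentiable[OF U]])
  then show "w = frechet_derivative (g \<circ> \<psi>) (at z) v"
    using frechet_derivative_transition[OF * g[OF U], of v'] v'(2) by simp
qed (intro exI conjI, use U in auto)

end

section \<open>The Jacobian of the normal exponential map\<close>

lemma det_frame_point_linear:
  "det (frame_matrix (\<alpha> *\<^sub>R v + \<beta> *\<^sub>R w) b) = \<alpha> * det (frame_matrix v b) + \<beta> * det (frame_matrix w b)"
proof -
  have row: "frame_matrix v b = (\<chi> i. if i = None then v else case_option 0 b i)" for v
    by (auto simp: frame_matrix_def vec_eq_iff split: option.split)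
  show ?thesis
    unfolding row det_row_add det_row_mul[folded scalar_mult_eq_scaleR] scalar_mult_eq_scaleR[symmetric] by simp
qed

lemma det_frame_normal_linear:
  "det (frame_matrix p (case_option (\<alpha> *\<^sub>R v + \<beta> *\<^sub>R w) e))
    = \<alpha> * det (frame_matrix p (case_option v e)) + \<beta> * det (frame_matrix p (case_option w e))"
proof -
  have row: "frame_matrix p (case_option v e) =
     (\<chi> i. if i = Some None then v else case_option p (case_option 0 e) i)" for v
    by (auto simp: frame_matrix_def vec_eq_iff split: option.split)
  show ?thesis
    unfolding row det_row_add det_row_mul[folded scalar_mult_eq_scaleR] scalar_mult_eq_scaleR[symmetric] by simp
qed

lemma det_frame_equal: "det (frame_matrix v (case_option v e)) = 0"
  by (rule det_identical_rows[of None "Some None"]) (simp_all add: row_def frame_matrix_def)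

text \<open>Polarisation: the determinant with \<open>v + w\<close> in both rows vanishes. The
  factors \<open>1\<close> bring the sum into the form of the linearity rules.\<close>

lemma det_frame_swap:
  "det (frame_matrix w (case_option v e)) = - det (frame_matrix v (case_option w e))"
  using det_frame_equal[of "1 *\<^sub>R v + 1 *\<^sub>R w" e] det_frame_equal[of v e] det_frame_equal[of w e]
  unfolding det_frame_point_linear det_frame_normal_linear mult_1 by linarith

text \<open>The factors \<open>a i\<close> come out of their rows; in the first two rows bilinearity
  and alternation leave a two-by-two determinant. In the application \<open>v\<close> and
  \<open>w\<close> are the point and the normal.\<close>

lemma det_frame_rotate:
  "det (frame_matrix (\<alpha> *\<^sub>R v + \<beta> *\<^sub>R w) (case_option (\<gamma> *\<^sub>R v + \<delta> *\<^sub>R w) (\<lambda>i. a i *\<^sub>R e i)))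
    = (\<alpha> * \<delta> - \<beta> * \<gamma>) * (\<Prod>i\<in>UNIV. a i) * det (frame_matrix v (case_option w e))"
proof -
  let ?D = "\<lambda>v w. det (frame_matrix v (case_option w (\<lambda>i. a i *\<^sub>R e i)))"
  define k where "k j = (case j of Some (Some i) \<Rightarrow> a i | _ \<Rightarrow> 1)" for j
  have "frame_matrix v (case_option w (\<lambda>i. a i *\<^sub>R e i)) = (\<chi> j. k j *s (frame_matrix v (case_option w e) $ j))"
    by (auto simp: frame_matrix_def k_def vec_eq_iff split: option.split)
  then have "?D v w = (\<Prod>j\<in>UNIV. k j) * det (frame_matrix v (case_option w e))"
    by (simp add: det_rows_mul)
  also have "(\<Prod>j\<in>UNIV. k j) = (\<Prod>i\<in>UNIV. a i)"
    by (simp add: prod_UNIV_option k_def)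
  finally have "?D v w = (\<Prod>i\<in>UNIV. a i) * det (frame_matrix v (case_option w e))" .
  moreover have "?D (\<alpha> *\<^sub>R v + \<beta> *\<^sub>R w) (\<gamma> *\<^sub>R v + \<delta> *\<^sub>R w) = (\<alpha> * \<delta> - \<beta> * \<gamma>) * ?D v w"
    by (simp add: det_frame_point_linear det_frame_normal_linear det_frame_equal det_frame_swap[of v w] algebra_simps)
  ultimately show ?thesis
    by simp
qed

lemma det_frame_linear_image:
  assumes "linear L"
  shows "det (frame_matrix (L p) (\<lambda>a. L (b a))) = det (matrix L) * det (frame_matrix p b)"
proof -
  have L: "matrix L *v v = L v" for v
    using fun_cong[OF matrix_vector_mul(2)[OF assms]] .
  have "(frame_matrix p b ** transpose (matrix L)) $ i = matrix L *v (frame_matrix p b $ i)" for i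
    by (simp add: vec_eq_iff matrix_matrix_mult_def matrix_vector_mult_def transpose_def mult.commute)
  then have "frame_matrix (L p) (\<lambda>a. L (b a)) = frame_matrix p b ** transpose (matrix L)"
    by (auto simp: vec_eq_iff[where 'b = "'a option option"] L frame_matrix_def split: option.split)
  then show ?thesis
    by (simp add: det_mul mult.commute)
qed

lemma bilinear_constant_derivative:
  fixes g h :: "'v::real_normed_vector \<Rightarrow> 'w::real_normed_vector" and B :: "'w \<Rightarrow> 'w \<Rightarrow> real"
  assumes B: "bounded_bilinear B" and U: "open U" "z \<in> U"
    and g: "g differentiable (at z)" and h: "h differentiable (at z)"
    and const: "\<And>y. y \<in> U \<Longrightarrow> B (g y) (h y) = c"
  shows "B (g z) (frechet_derivative h (at z) v) + B (frechet_derivative g (at z) v) (h z) = 0"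
proof -
  have "((\<lambda>y. B (g y) (h y)) has_derivative
      (\<lambda>v. B (g z) (frechet_derivative h (at z) v) + B (frechet_derivative g (at z) v) (h z))) (at z)"
    using g h by (intro bounded_bilinear.FDERIV[OF B]) (simp_all add: frechet_derivative_works)
  moreover have "((\<lambda>y. B (g y) (h y)) has_derivative (\<lambda>v. 0)) (at z)"
    by (rule has_derivative_transform_within_open[OF has_derivative_const U]) (simp add: const)
  ultimately have "(\<lambda>v. B (g z) (frechet_derivative h (at z) v) + B (frechet_derivative g (at z) v) (h z)) = (\<lambda>v. 0)"
    by (rule has_derivative_unique)
  then show ?thesis
    by (rule fun_cong)
qed

section \<open>The normal exponential map in charts and its Jacobian\<close>

context
  fixes K :: real and M :: "'a::topological_space set" and A :: "('n::finite, 'a) atlas"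
    and f \<nu> :: "'a \<Rightarrow> real^('n option option)" and \<Omega> :: "(real^('n option option)) set"
  assumes K: "K \<in> {0, 1, -1}" and hyp: "closed_embedded_hypersurface K M A f"
    and normal: "outward_unit_normal K M A f \<Omega> \<nu>"
begin

lemma immersion_point: "x \<in> M \<Longrightarrow> f x \<in> space_form K"
  using hyp by (auto simp: closed_embedded_hypersurface_def)

lemma normal_tangent: "x \<in> M \<Longrightarrow> \<nu> x \<in> sf_tangent K (f x)"
  and normal_unit: "x \<in> M \<Longrightarrow> metric K (\<nu> x) (\<nu> x) = 1"
  and normal_orthogonal: "x \<in> M \<Longrightarrow> X \<in> tangent_space A f x \<Longrightarrow> metric K (\<nu> x) X = 0"
  using normal by (auto simp: outward_unit_normal_def)

lemma normal_differentiable: "(U, \<psi>) \<in> A \<Longrightarrow> z \<in> U \<Longrightarrow> (\<nu> \<circ> \<psi>) differentiable (at z)"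
  using normal by (intro differentiable_chart[OF hyp]) (simp_all add: outward_unit_normal_def)

lemma normal_exp_eq:
  "x \<in> M \<Longrightarrow> normal_exp K f \<nu> x t = c_fun K t *\<^sub>R f x + s_fun K t *\<^sub>R \<nu> x"
  unfolding normal_exp_def by (intro exp_map_normal K immersion_point normal_tangent normal_unit)

lemma normal_exp_velocity:
  assumes "x \<in> M"
  shows "vector_derivative (normal_exp K f \<nu> x) (at t) = (- K * s_fun K t) *\<^sub>R f x + c_fun K t *\<^sub>R \<nu> x"
proof -
  have "normal_exp K f \<nu> x = (\<lambda>t. c_fun K t *\<^sub>R f x + s_fun K t *\<^sub>R \<nu> x)"
    using normal_exp_eq[OF assms] by blast
  moreover have "((\<lambda>t. c_fun K t *\<^sub>R f x + s_fun K t *\<^sub>R \<nu> x) has_vector_derivative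
      (- K * s_fun K t) *\<^sub>R f x + c_fun K t *\<^sub>R \<nu> x) (at t)"
    using c_fun_has_derivative[OF K, of t] s_fun_has_derivative[OF K, of t]
    by (auto intro!: derivative_eq_intros)
  ultimately show ?thesis
    by (simp add: vector_derivative_at)
qed

lemma chart_subset: "(U, \<psi>) \<in> A \<Longrightarrow> z \<in> U \<Longrightarrow> \<psi> z \<in> M"
  using smooth_atlasD(4)[OF atlas[OF hyp]] by blast

lemma normal_exp_chart_has_derivative:
  assumes U: "(U, \<psi>) \<in> A" "z \<in> U"
  shows "((\<lambda>y. normal_exp K f \<nu> y t) \<circ> \<psi> has_derivative
      (\<lambda>v. c_fun K t *\<^sub>R frechet_derivative (f \<circ> \<psi>) (at z) v + s_fun K t *\<^sub>R frechet_derivative (\<nu> \<circ> \<psi>) (at z) v)) (at z)"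
\<comment> \<open>The closed form of \<open>normal_exp\<close> is known only over \<open>M\<close>,
  so the derivative is transferred within the chart domain \<open>U\<close>.\<close>
proof (rule has_derivative_transform_within_open)
  show "((\<lambda>y. c_fun K t *\<^sub>R (f \<circ> \<psi>) y + s_fun K t *\<^sub>R (\<nu> \<circ> \<psi>) y) has_derivative
      (\<lambda>v. c_fun K t *\<^sub>R frechet_derivative (f \<circ> \<psi>) (at z) v + s_fun K t *\<^sub>R frechet_derivative (\<nu> \<circ> \<psi>) (at z) v)) (at z)"
    using immersion_differentiable[OF hyp U] normal_differentiable[OF U]
    unfolding frechet_derivative_works by (intro has_derivative_add has_derivative_scaleR_right)
  show "open U" "z \<in> U"
    using smooth_atlasD(1)[OF atlas[OF hyp] U(1)] U by auto
qed (simp add: normal_exp_eq chart_subset[OF U(1)])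

lemma differential_normal_exp:
  assumes U: "(U, \<psi>) \<in> A" "z \<in> U"
  shows "differential A f (\<lambda>y. normal_exp K f \<nu> y t) (\<psi> z) (frechet_derivative (f \<circ> \<psi>) (at z) v)
     = c_fun K t *\<^sub>R frechet_derivative (f \<circ> \<psi>) (at z) v + s_fun K t *\<^sub>R frechet_derivative (\<nu> \<circ> \<psi>) (at z) v"
proof -
  have "((\<lambda>y. normal_exp K f \<nu> y t) \<circ> \<eta>) differentiable (at y)" if "(V, \<eta>) \<in> A" "y \<in> V" for V \<eta> y
    using normal_exp_chart_has_derivative[OF that] unfolding differentiable_def by blast
  then show ?thesis
    using differential_chart[OF hyp _ U, of "\<lambda>y. normal_exp K f \<nu> y t" v]
      frechet_derivative_at[OF normal_exp_chart_has_derivative[OF U, of t]]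
    by (simp add: fun_eq_iff)
qed

text \<open>Apart from the second claim, which is the orthogonality of the normal, each comes from
  differentiating a constant product: \<open>f\<close> with \<open>f\<close>, \<open>f\<close> with
  \<open>\<nu>\<close>, \<open>\<nu>\<close> with \<open>\<nu>\<close>.\<close>

lemma chart_derivatives_tangent:
  assumes U: "(U, \<psi>) \<in> A" "z \<in> U"
  shows "pairing K (f (\<psi> z)) (frechet_derivative (f \<circ> \<psi>) (at z) v) = 0" (is ?f)
    and "metric K (\<nu> (\<psi> z)) (frechet_derivative (f \<circ> \<psi>) (at z) v) = 0" (is ?\<nu>f)
    and "pairing K (f (\<psi> z)) (frechet_derivative (\<nu> \<circ> \<psi>) (at z) v) = 0" (is ?f\<nu>)
    and "metric K (\<nu> (\<psi> z)) (frechet_derivative (\<nu> \<circ> \<psi>) (at z) v) = 0" (is ?\<nu>)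
proof -
  have "open U"
    by (rule smooth_atlasD(1)[OF atlas[OF hyp] U(1)])
  note M = chart_subset[OF U(1)]
  note df = immersion_differentiable[OF hyp U] and d\<nu> = normal_differentiable[OF U]
  note const = bilinear_constant_derivative[OF _ \<open>open U\<close> U(2)]
  show ?f
    using const[OF bounded_bilinear_pairing df df, of K 1 v] immersion_point[OF M]
    by (simp add: space_form_iff pairing_commute[of K "frechet_derivative _ _ _"])
  show ?\<nu>f
    using normal_orthogonal[OF M[OF U(2)]] by (simp add: tangent_space_chart[OF hyp U])
  show ?\<nu>
    using const[OF bounded_bilinear_metric d\<nu> d\<nu>, of K 1 v] normal_unit[OF M]
    by (simp add: metric_commute[of K "frechet_derivative _ _ _"])
  \<comment> \<open>The product rule for \<open>f\<close> with \<open>\<nu>\<close> also produces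
    this term. It reduces to metric orthogonality; for \<open>K = 0\<close> the conversion rests on
    the vanishing \<open>None\<close> coordinate of tangent vectors.\<close>
  have "pairing K (frechet_derivative (f \<circ> \<psi>) (at z) v) (\<nu> (\<psi> z)) = 0"
  proof (subst pairing_eq_metric[OF K])
    assume "K = 0"
    then show "frechet_derivative (f \<circ> \<psi>) (at z) v $ None * \<nu> (\<psi> z) $ None = 0"
      using \<open>?f\<close> immersion_point[OF M[OF U(2)]] by (auto simp: pairing_def space_form_iff)
  next
    show "K * metric K (frechet_derivative (f \<circ> \<psi>) (at z) v) (\<nu> (\<psi> z)) = 0"
      using \<open>?\<nu>f\<close> by (simp add: metric_commute)
  qed
  then show ?f\<nu>
    using const[OF bounded_bilinear_pairing df d\<nu>, of K 0 v] normal_tangent[OF M]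
    by (simp add: sf_tangent_iff)
qed

text \<open>For nonzero \<open>K\<close> the correction term of \<open>tangential\<close> vanishes
  because the derivative of \<open>\<nu>\<close> is orthogonal to the point. Principal curvatures
  can then be read from the plain derivative.\<close>

lemma tangential_normal_derivative:
  assumes U: "(U, \<psi>) \<in> A" "z \<in> U"
  shows "tangential K (f (\<psi> z)) (frechet_derivative (\<nu> \<circ> \<psi>) (at z) v) = frechet_derivative (\<nu> \<circ> \<psi>) (at z) v"
proof (cases "K = 0")
  case False
  have "K * metric K (frechet_derivative (\<nu> \<circ> \<psi>) (at z) v) (f (\<psi> z)) = 0"
    using pairing_eq_metric[OF K, of "f (\<psi> z)" "frechet_derivative (\<nu> \<circ> \<psi>) (at z) v"]
      chart_derivatives_tangent(3)[OF U, of v] False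
    by (simp add: metric_commute)
  then show ?thesis
    by (simp add: tangential_def)
qed (simp add: tangential_def)

lemma tangent_frame_orthonormal:
  assumes x: "x \<in> M" and e: "orthonormal_frame K A f x e"
  shows "tangent_frame K (f x) (case_option (\<nu> x) e)"
proof
  have e': "e i \<in> tangent_space A f x" "metric K (e i) (e j) = (if i = j then 1 else 0)" for i j
    using e by (auto simp: orthonormal_frame_def)
  obtain U \<psi> z where U: "(U, \<psi>) \<in> A" "z \<in> U" "\<psi> z = x"
    using x by (rule chart_at[OF hyp])
  have "e i \<in> sf_tangent K (f x)" for i
    using e'(1)[of i] chart_derivatives_tangent(1)[OF U(1,2)]
    by (auto simp: sf_tangent_iff tangent_space_chart[OF hyp U(1,2)] simp flip: U(3))
  then show "case_option (\<nu> x) e a \<in> sf_tangent K (f x)" for a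
    using normal_tangent[OF x] by (simp split: option.split)
  show "metric K (case_option (\<nu> x) e a) (case_option (\<nu> x) e a') = (if a = a' then 1 else 0)" for a a'
    using e' normal_unit[OF x] normal_orthogonal[OF x e'(1)]
    by (auto simp: metric_commute[of K "e _" "\<nu> x"] split: option.split)
qed (use K immersion_point[OF x] in auto)

text \<open>All frames are moved by the same linear map \<open>L\<close>, so the signed determinant is \<open>det L\<close>
  whatever the frame, and a principal frame diagonalises \<open>L\<close> outside the plane of
  \<open>f x\<close> and \<open>\<nu> x\<close>, on which \<open>L\<close> has determinant 1.\<close>

lemma jacobian_eq_prod:
  assumes x: "x \<in> M" and l: "principal_curvatures K A f \<nu> x l"
  shows "jacobian K A f \<nu> x t = (\<Prod>i\<in>UNIV. s_fun K t * l i + c_fun K t)"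
proof -
  obtain U \<psi> z where U: "(U, \<psi>) \<in> A" "z \<in> U" and z: "\<psi> z = x"
    using x by (rule chart_at[OF hyp])
  let ?c = "c_fun K t" and ?s = "s_fun K t"
  define F where "F = frechet_derivative (f \<circ> \<psi>) (at z)"
  define N where "N = frechet_derivative (\<nu> \<circ> \<psi>) (at z)"
  have linF: "linear F" and linN: "linear N"
    unfolding F_def N_def
    by (intro linear_frechet_derivative immersion_differentiable[OF hyp U] normal_differentiable[OF U])+
  have "inj F"
    unfolding F_def by (rule immersion_inj[OF hyp U])
  \<comment> \<open>With this left inverse of the differential of \<open>f\<close>,
    \<open>N (g X)\<close> is the derivative of \<open>\<nu>\<close> along a tangent vector
    \<open>X\<close>, as a linear map on the whole ambient space.\<close>
  then obtain g where g: "linear g" "g \<circ> F = id"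
    using linear_injective_left_inverse[OF linF] by blast
  have gF: "g (F v) = v" for v
    using fun_cong[OF g(2), of v] by simp
  note derivs = chart_derivatives_tangent[OF U, folded F_def N_def, unfolded z]
  have p: "pairing K (f x) (f x) = 1" "pairing K (f x) (\<nu> x) = 0" "metric K (\<nu> x) (\<nu> x) = 1"
    using immersion_point[OF x] normal_tangent[OF x] normal_unit[OF x]
    by (auto simp: space_form_iff sf_tangent_iff)
  \<comment> \<open>\<open>\<alpha>\<close>, \<open>\<beta>\<close> and \<open>\<tau>\<close> split
    a vector into its parts along the point, the normal and the hypersurface. \<open>L\<close> sends
    the point to its image at time \<open>t\<close>, the normal to the velocity there, and a tangent
    vector to its image under the differential.\<close>
  define \<alpha> where "\<alpha> v = pairing K (f x) v" for v
  define \<beta> where "\<beta> v = metric K (\<nu> x) (v - \<alpha> v *\<^sub>R f x)" for v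
  define \<tau> where "\<tau> v = v - \<alpha> v *\<^sub>R f x - \<beta> v *\<^sub>R \<nu> x" for v
  define L where "L v = \<alpha> v *\<^sub>R (?c *\<^sub>R f x + ?s *\<^sub>R \<nu> x) + \<beta> v *\<^sub>R ((- K * ?s) *\<^sub>R f x + ?c *\<^sub>R \<nu> x)
      + (?c *\<^sub>R \<tau> v + ?s *\<^sub>R N (g (\<tau> v)))" for v
  have lin\<alpha>: "linear \<alpha>"
    by (rule linearI) (simp_all add: \<alpha>_def pairing_simps)
  have lin\<beta>: "linear \<beta>"
    by (rule linearI) (simp_all add: \<beta>_def metric_simps linear_add[OF lin\<alpha>] linear_cmul[OF lin\<alpha>] algebra_simps)
  have lin\<tau>: "linear \<tau>"
    by (rule linearI) (simp_all add: \<tau>_def linear_add[OF lin\<alpha>] linear_cmul[OF lin\<alpha>]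
        linear_add[OF lin\<beta>] linear_cmul[OF lin\<beta>] algebra_simps)
  have linL: "linear L"
    by (rule linearI) (simp_all only: L_def linear_add[OF lin\<alpha>] linear_cmul[OF lin\<alpha>] linear_add[OF lin\<beta>]
        linear_cmul[OF lin\<beta>] linear_add[OF lin\<tau>] linear_cmul[OF lin\<tau>] linear_add[OF g(1)]
        linear_cmul[OF g(1)] linear_add[OF linN] linear_cmul[OF linN], simp_all add: algebra_simps)
  have Lp: "L (f x) = ?c *\<^sub>R f x + ?s *\<^sub>R \<nu> x"
    using p linear_0[OF linN] linear_0[OF g(1)]
    by (simp add: L_def \<tau>_def \<beta>_def \<alpha>_def metric_simps)
  have L\<nu>: "L (\<nu> x) = (- K * ?s) *\<^sub>R f x + ?c *\<^sub>R \<nu> x"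
    using p linear_0[OF linN] linear_0[OF g(1)]
    by (simp add: L_def \<tau>_def \<beta>_def \<alpha>_def)
  have LF: "L (F v) = ?c *\<^sub>R F v + ?s *\<^sub>R N v" for v
    using derivs by (simp add: L_def \<tau>_def \<beta>_def \<alpha>_def gF)
  have range: "tangent_space A f x = range F"
    using tangent_space_chart[OF hyp U] by (simp add: z F_def)
  have frame_jacobian: "frame_jacobian K A f \<nu> e x t = det (matrix L) * det (frame_matrix (f x) (case_option (\<nu> x) e))"
    if e: "orthonormal_frame K A f x e" for e
  proof -
    have "differential A f (\<lambda>y. normal_exp K f \<nu> y t) x (e i) = L (e i)" for i
    proof -
      have "e i \<in> range F"
        using e range by (simp add: orthonormal_frame_def)
      then obtain v where v: "e i = F v"
        by blast
      show ?thesis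
        using differential_normal_exp[OF U, of t v] by (simp add: v LF z flip: F_def N_def)
    qed
    then have "frame_jacobian K A f \<nu> e x t = det (frame_matrix (L (f x)) (case_option (L (\<nu> x)) (\<lambda>i. L (e i))))"
      by (simp add: frame_jacobian_def volume_form_eq_det Lp L\<nu> normal_exp_eq[OF x] normal_exp_velocity[OF x])
    also have "case_option (L (\<nu> x)) (\<lambda>i. L (e i)) = (\<lambda>a. L (case_option (\<nu> x) e a))"
      by (auto split: option.split)
    finally show ?thesis
      by (simp add: det_frame_linear_image[OF linL])
  qed
  have frame_jacobian_0: "frame_jacobian K A f \<nu> e x 0 = det (frame_matrix (f x) (case_option (\<nu> x) e))"
    if e: "orthonormal_frame K A f x e" for e
  proof -
    have "differential A f (\<lambda>y. normal_exp K f \<nu> y 0) x (e i) = e i" for i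
    proof -
      have "e i \<in> range F"
        using e range by (simp add: orthonormal_frame_def)
      then obtain v where v: "e i = F v"
        by blast
      show ?thesis
        using differential_normal_exp[OF U, of 0 v] by (simp add: v z flip: F_def N_def)
    qed
    then show ?thesis
      by (simp add: frame_jacobian_def volume_form_eq_det normal_exp_eq[OF x] normal_exp_velocity[OF x])
  qed
  \<comment> \<open>The determinant of the completed frame has absolute value \<open>1\<close>, so
    multiplying by its sign removes it.\<close>
  have signed: "sgn (frame_jacobian K A f \<nu> e x 0) * frame_jacobian K A f \<nu> e x t = det (matrix L)"
    if e: "orthonormal_frame K A f x e" for e
    using tangent_frame.abs_det_frame[OF tangent_frame_orthonormal[OF x e]]
    unfolding frame_jacobian[OF e] frame_jacobian_0[OF e] by (auto simp: abs_if split: if_splits)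
  obtain e where e: "orthonormal_frame K A f x e"
    and A: "\<And>i j. second_fundamental_form K A f \<nu> x (e i) (e j) = (if i = j then l i else 0)"
    using l by (auto simp: principal_curvatures_def)
  interpret tangent_frame K "f x" "case_option (\<nu> x) e"
    by (rule tangent_frame_orthonormal[OF x e])
  have "jacobian K A f \<nu> x t = det (matrix L)"
    unfolding jacobian_def by (rule the_equality) (use e signed in auto)
  also have "det (matrix L) = (\<Prod>i\<in>UNIV. ?s * l i + ?c)"
  proof -
    have Le: "L (e i) = (?s * l i + ?c) *\<^sub>R e i" for i
    proof -
      have "e i \<in> range F"
        using e range by (simp add: orthonormal_frame_def)
      then obtain v where v: "e i = F v"
        by blast
      have "differential A f \<nu> x (e i) = N v"
        using differential_chart[OF hyp normal_differentiable U, where v = v] by (simp add: v z F_def N_def)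
      then have II: "metric K (N v) (e j) = (if i = j then l i else 0)" for j
        using A[of i j] tangential_normal_derivative[OF U, of v]
        by (simp add: second_fundamental_form_def z flip: N_def)
      \<comment> \<open>The difference is tangent to the space form and orthogonal to the normal and
        to every \<open>e j\<close>, hence zero by nondegeneracy.\<close>
      have "N v - l i *\<^sub>R e i = 0"
      proof (rule eq_zeroI)
        show "N v - l i *\<^sub>R e i \<in> sf_tangent K (f x)"
          using derivs by (simp add: sf_tangent_iff pairing_simps v)
        show "metric K (case_option (\<nu> x) e a) (N v - l i *\<^sub>R e i) = 0" for a
        proof (cases a)
          case None
          then show ?thesis
            using derivs by (simp add: metric_simps v)
        next
          case (Some j)
          then show ?thesis
            using orthonormal[of "Some j" "Some i"] II[of j]
            by (auto simp: metric_simps metric_commute[of K "e j" "N v"])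
        qed
      qed
      then show ?thesis
        by (simp add: v LF algebra_simps)
    qed
    have "det (matrix L) * det (frame_matrix (f x) (case_option (\<nu> x) e))
        = det (frame_matrix (L (f x)) (case_option (L (\<nu> x)) (\<lambda>i. L (e i))))"
    proof -
      have "case_option (L (\<nu> x)) (\<lambda>i. L (e i)) = (\<lambda>a. L (case_option (\<nu> x) e a))"
        by (auto split: option.split)
      then show ?thesis
        by (simp add: det_frame_linear_image[OF linL])
    qed
    also have "\<dots> = (?c * ?c - ?s * (- K * ?s)) * (\<Prod>i\<in>UNIV. ?s * l i + ?c) *
        det (frame_matrix (f x) (case_option (\<nu> x) e))"
      unfolding Lp L\<nu> Le by (rule det_frame_rotate)
    also have "?c * ?c - ?s * (- K * ?s) = 1"
      using c_fun_s_fun_identity[OF K, of t] by (simp add: mult_ac)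
    finally show ?thesis
      using abs_det_frame by (auto simp: abs_if split: if_splits)
  qed
  finally show ?thesis .
qed

end

section \<open>Integration along the normals\<close>

text \<open>Each subset \<open>X\<close> records the factors from which \<open>s * l i\<close> is
  chosen; grouping by size produces \<open>elem_sym\<close>. The final index reversal matches the
  exponents in \<open>phi_fun\<close>.\<close>

lemma prod_linear_eq_elem_sym:
  fixes l :: "'n::finite \<Rightarrow> real"
  shows "(\<Prod>i\<in>UNIV. s * l i + c) = (\<Sum>i=0..CARD('n). elem_sym (CARD('n) - i) l * (s ^ (CARD('n) - i) * c ^ i))"
proof -
  let ?n = "CARD('n)"
  have "(\<Prod>i\<in>UNIV. s * l i + c) = (\<Sum>X\<in>UNIV. (\<Prod>i\<in>X. l i) * (s ^ card X * c ^ (?n - card X)))"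
    by (simp add: prod_add prod.distrib card_Diff_subset mult_ac)
  also have "\<dots> = (\<Sum>k\<in>{0..?n}. \<Sum>X | X \<in> UNIV \<and> card X = k. (\<Prod>i\<in>X. l i) * (s ^ card X * c ^ (?n - card X)))"
    by (rule sum.group[symmetric]) (auto simp: card_mono)
  also have "\<dots> = (\<Sum>k\<in>{0..?n}. elem_sym k l * (s ^ k * c ^ (?n - k)))"
    by (simp add: elem_sym_def sum_distrib_right)
  also have "\<dots> = (\<Sum>i\<in>{0..?n}. elem_sym (?n - i) l * (s ^ (?n - i) * c ^ i))"
    by (subst sum.atLeastAtMost_rev) (auto intro!: sum.cong)
  finally show ?thesis .
qed

text \<open>Integrability is carried through the induction, since splitting off a summand requires
  both parts to be integrable.\<close>

lemma interval_integral_linear_combination: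
  fixes g :: "'i \<Rightarrow> real \<Rightarrow> real" and a b :: real
  assumes "finite I" and g: "\<And>i t. i \<in> I \<Longrightarrow> isCont (g i) t"
  shows "interval_lebesgue_integrable lborel a b (\<lambda>t. \<Sum>i\<in>I. h i * g i t) \<and>
    (LBINT t=a..b. (\<Sum>i\<in>I. h i * g i t)) = (\<Sum>i\<in>I. h i * (LBINT t=a..b. g i t))"
  using assms
proof (induction rule: finite_induct)
  case empty
  then show ?case
    by (simp add: interval_lebesgue_integrable_def interval_lebesgue_integral_def set_integrable_def set_lebesgue_integral_def)
next
  case (insert j I)
  have "interval_lebesgue_integrable lborel a b (g j)"
    using insert.prems by (intro interval_integrable_isCont) auto
  with insert show ?case
    by simp
qed

lemma isCont_s_fun_c_fun:
  assumes "K \<in> {0, 1, -1}"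
  shows "isCont (\<lambda>t. s_fun K t ^ j * c_fun K t ^ i) t"
  using DERIV_isCont[OF s_fun_has_derivative[OF assms]] DERIV_isCont[OF c_fun_has_derivative[OF assms]]
  by (intro continuous_intros) auto

lemma phi_fun_flat: "i \<le> n \<Longrightarrow> phi_fun n 0 i s = s ^ (n - i + 1) / real (n - i + 1)"
proof -
  have "(LBINT t=ereal 0..ereal s. t ^ (n - i)) = s ^ (n - i + 1) / real (n - i + 1) - 0 ^ (n - i + 1) / real (n - i + 1)"
  proof (rule interval_integral_FTC_finite)
    \<comment> \<open>\<open>s\<close> may be negative, hence the \<open>min\<close> and
      \<open>max\<close> for the oriented integral.\<close>
    show "continuous_on {min 0 s..max 0 s} (\<lambda>t. t ^ (n - i))"
      by (intro continuous_intros)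
    show "((\<lambda>t. t ^ (n - i + 1) / real (n - i + 1)) has_vector_derivative t ^ (n - i)) (at t within {min 0 s..max 0 s})" for t
      unfolding has_real_derivative_iff_has_vector_derivative[symmetric]
      using DERIV_cdivide[OF DERIV_pow[of "n - i + 1" t], of "real (n - i + 1)"] by (simp del: of_nat_Suc)
  qed
  then show ?thesis
    by (simp add: phi_fun_def s_fun_def c_fun_def flip: zero_ereal_def)
qed

theorem proposition8:
  fixes K :: real
    and M :: "'a::topological_space set"
    and A :: "('n::finite, 'a) atlas"
    and f \<nu> :: "'a \<Rightarrow> real^('n option option)"
    and \<Omega> :: "(real^('n option option)) set"
    and vol :: "(real^('n option option)) measure"
    and \<mu> :: "'a measure"
    and \<kappa> :: "'a \<Rightarrow> 'n \<Rightarrow> real"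
    and H :: "nat \<Rightarrow> 'a \<Rightarrow> real"
    and u :: "'a \<Rightarrow> real"
    and n :: nat
  assumes "K \<in> {0, 1, -1}"
    and "n = CARD('n)"
    and "closed_embedded_hypersurface K M A f"
    and "enclosed_domain K M f \<Omega>"
    and "outward_unit_normal K M A f \<Omega> \<nu>"
    and "space_form_volume K vol"
    and "riemannian_measure K M A f \<mu>"
    and "\<And>x. x \<in> M \<Longrightarrow> principal_curvatures K A f \<nu> x (\<kappa> x)"
    and "\<And>k x. H k x = elem_sym k (\<kappa> x)"
    and "continuous_on M u"
  shows "oriented_volume K A f \<nu> vol \<Omega> \<mu> u =
           measure vol \<Omega> + (LINT x|\<mu>. (\<Sum>i=0..n. H (n - i) x * phi_fun n K i (u x)))
       \<and> (K = 0 \<longrightarrow> oriented_volume K A f \<nu> vol \<Omega> \<mu> u =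
           measure vol \<Omega> + (LINT x|\<mu>. (\<Sum>k=0..n. H k x / real (k + 1) * u x ^ (k + 1))))"
proof -
  have sets: "sets \<mu> = sets (restrict_space borel M)"
    using assms(7) by (simp add: riemannian_measure_def)
  \<comment> \<open>The Jacobian formula is available at points of \<open>M\<close>; with this
    identity it covers the whole domain of integration.\<close>
  have space: "space \<mu> = M"
    using sets_eq_imp_space_eq[OF sets] by (simp add: space_restrict_space)
  have "(LBINT t=0..ereal (u x). jacobian K A f \<nu> x t) = (\<Sum>i=0..n. H (n - i) x * phi_fun n K i (u x))"
    if "x \<in> M" for x
  proof -
    have "jacobian K A f \<nu> x t = (\<Sum>i=0..n. H (n - i) x * (s_fun K t ^ (n - i) * c_fun K t ^ i))" for t
      using jacobian_eq_prod[OF assms(1,3,5) that assms(8)[OF that]]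
      by (simp only: prod_linear_eq_elem_sym assms(2,9))
    moreover have "(LBINT t=ereal 0..ereal (u x). (\<Sum>i=0..n. H (n - i) x * (s_fun K t ^ (n - i) * c_fun K t ^ i)))
        = (\<Sum>i=0..n. H (n - i) x * (LBINT t=ereal 0..ereal (u x). s_fun K t ^ (n - i) * c_fun K t ^ i))"
      by (rule interval_integral_linear_combination[THEN conjunct2]) (simp_all add: isCont_s_fun_c_fun[OF assms(1)])
    ultimately show ?thesis
      by (simp add: phi_fun_def flip: zero_ereal_def)
  qed
  then have general: "oriented_volume K A f \<nu> vol \<Omega> \<mu> u =
      measure vol \<Omega> + (LINT x|\<mu>. (\<Sum>i=0..n. H (n - i) x * phi_fun n K i (u x)))"
    unfolding oriented_volume_def
    by (intro arg_cong[where f = "(+) _"] Bochner_Integration.integral_cong refl) (simp add: space)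
  \<comment> \<open>Reversal substitutes \<open>k = n - i\<close>, which turns the exponent
    \<open>n - i + 1\<close> of \<open>phi_fun_flat\<close> into \<open>k + 1\<close>.\<close>
  have flat: "(\<Sum>i=0..n. H (n - i) x * phi_fun n 0 i (u x)) = (\<Sum>k=0..n. H k x / real (k + 1) * u x ^ (k + 1))" for x
    by (subst sum.atLeastAtMost_rev) (simp add: phi_fun_flat)
  show ?thesis
  proof (intro conjI impI)
    assume "K = 0"
    then show "oriented_volume K A f \<nu> vol \<Omega> \<mu> u =
        measure vol \<Omega> + (LINT x|\<mu>. (\<Sum>k=0..n. H k x / real (k + 1) * u x ^ (k + 1)))"
      unfolding general by (simp only: flat)
  qed (rule general)
qed

end
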